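(* Let $d\ge 2$ and $k\ge 1$ be integers, and let $n = p\sum_{j=0}^k d^j + q$ where $p\ge 1$ and $$1\le q\le \min\Big\{1+2\sum_{j=0}^{k-1} d^j,\ \sum_{j=1}^k d^j\Big\}.$$ Then $\gamma_k(G_B(n,d)) = \left\lceil n/\sum_{j=0}^k d^j\right\rceil$.
   Context: The generalized de Bruijn digraph $G_B(n,d)$ has vertex set $\{0,1,\dots,n-1\}$ and an arc $(x,y)$ whenever $y\equiv dx+i \pmod n$ for some $0\le i\le d-1$ (self-loops allowed). A set $D\subseteq V(G)$ of a digraph $G$ is a distance $k$-dominating set if every vertex $v\notin D$ has some $u\in D$ with a directed path from $u$ to $v$ of length at most $k$. $\gamma_k(G)$ denotes the minimum cardinality of a distance $k$-dominating set of $G$. *)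

theory Defs
  imports Complex_Main "HOL-Number_Theory.Cong" "Graph_Theory.Graph_Theory"
begin

definition gen_de_bruijn :: "nat \<Rightarrow> nat \<Rightarrow> nat pair_pre_digraph" where
  "gen_de_bruijn n d =
     \<lparr> pverts = {0..<n},
       parcs = {(x, y). x \<in> {0..<n} \<and> y \<in> {0..<n} \<and> (\<exists>i<d. [y = d * x + i] (mod n))} \<rparr>"

definition dist_dominating :: "('a, 'b) pre_digraph \<Rightarrow> nat \<Rightarrow> 'a set \<Rightarrow> bool" where
  "dist_dominating G k D \<longleftrightarrow> D \<subseteq> verts G \<and>
     (\<forall>v \<in> verts G - D. \<exists>u \<in> D. \<exists>p. pre_digraph.apath G u p v \<and> length p \<le> k)"

(* The finiteness condition matters only when the vertex set is infinite: infinite sets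
   have card 0 and must not count as minimum dominating sets. *)
definition dist_domination_number :: "nat \<Rightarrow> ('a, 'b) pre_digraph \<Rightarrow> nat" where
  "dist_domination_number k G =
     (LEAST m. \<exists>D. finite D \<and> dist_dominating G k D \<and> card D = m)"

end

theory Submission
  imports Defs
begin

text \<open>
  The vertices reached from \<open>u\<close> by walks of length \<open>j\<close> are the residues of the \<open>d ^ j\<close>
  consecutive integers starting at \<open>d ^ j * u\<close>, so a vertex dominates at most
  \<open>S = (\<Sum>j\<le>k. d ^ j)\<close> vertices; this gives the lower bound \<open>n \<le> S * card D\<close>.

  For the upper bound put \<open>m = p + 1\<close> and write \<open>m = (d - 1) * x + c\<close> with \<open>c < d - 1\<close>.
  The block \<open>D = {x..<x + m}\<close> reaches in \<open>j\<close> steps the residues of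
  \<open>{d ^ j * x..<d ^ j * (x + m)}\<close>. Since \<open>d ^ (j + 1) * x = d ^ j * (x + m) - d ^ j * c\<close>,
  these intervals join up without gaps for \<open>j = 0, \<dots>, k\<close>. Their union has length
  \<open>m * S - c * (\<Sum>j<k. d ^ j)\<close>, which is at least \<open>n\<close> because \<open>c \<le> d - 2\<close> and
  \<open>q \<le> 1 + 2 * (\<Sum>j<k. d ^ j)\<close>.
\<close>

text \<open>Cutting a cycle out of a walk only shortens it. Hence domination, defined by paths, can
  be tested on walks, whose endpoints have a simple arithmetic description.\<close>

lemma (in wf_digraph) awalk_imp_short_apath:
  assumes "awalk u p v"
  shows "\<exists>q. apath u q v \<and> length q \<le> length p"
  using assms
proof (induction rule: awalk_to_apath_induct)
  case (path p)
  then show ?case by (auto simp: apath_def)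
next
  case (decomp p q r s)
  then have "p = q @ r @ s"
    using awalk_cyc_decompE[of p q r s u v] by metis
  with decomp show ?case by fastforce
qed

lemma pverts_gen_de_bruijn [simp]: "pverts (gen_de_bruijn n d) = {0..<n}"
  by (simp add: gen_de_bruijn_def)

lemma wf_digraph_gen_de_bruijn: "wf_digraph (with_proj (gen_de_bruijn n d))"
  by unfold_locales (auto simp: gen_de_bruijn_def)

lemma gen_de_bruijn_arc_iff:
  assumes "x < n"
  shows "(x, y) \<in> parcs (gen_de_bruijn n d) \<longleftrightarrow> (\<exists>i<d. y = (d * x + i) mod n)"
  using assms by (auto simp: gen_de_bruijn_def cong_def)

text \<open>A walk of length \<open>j\<close> chooses the \<open>j\<close> base-\<open>d\<close>
  digits of the offset \<open>r\<close>, the first arc fixing the leading digit; hence the induction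
  peels off the first arc.\<close>

lemma gen_de_bruijn_awalk_iff:
  assumes "u < n"
  shows "(\<exists>p. pre_digraph.awalk (with_proj (gen_de_bruijn n d)) u p v \<and> length p = j)
           \<longleftrightarrow> (\<exists>r<d ^ j. v = (d ^ j * u + r) mod n)"
proof -
  interpret wf_digraph "with_proj (gen_de_bruijn n d)"
    by (rule wf_digraph_gen_de_bruijn)
  show ?thesis
    using assms
  proof (induction j arbitrary: u)
    case 0
    then show ?case by (auto simp: awalk_Nil_iff)
  next
    case (Suc j)
    have residue: "(d ^ j * ((d * u + i) mod n) + r) mod n = (d ^ Suc j * u + (d ^ j * i + r)) mod n"
      for i r
    proof -
      have "(d ^ j * ((d * u + i) mod n) + r) mod n = (d ^ j * (d * u + i) + r) mod n"
        by (metis mod_add_left_eq mod_mult_right_eq)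
      then show ?thesis by (simp add: algebra_simps)
    qed
    have "(\<exists>p. awalk u p v \<and> length p = Suc j)
        \<longleftrightarrow> (\<exists>w. (u, w) \<in> parcs (gen_de_bruijn n d) \<and> (\<exists>p. awalk w p v \<and> length p = j))"
    proof safe
      fix p assume "awalk u p v" "length p = Suc j"
      then obtain e es where "awalk u (e # es) v" "length es = j"
        by (auto simp: length_Suc_conv)
      then show "\<exists>w. (u, w) \<in> parcs (gen_de_bruijn n d) \<and> (\<exists>p. awalk w p v \<and> length p = j)"
        by (cases e) (auto simp: awalk_Cons_iff)
    next
      fix w p assume "(u, w) \<in> parcs (gen_de_bruijn n d)" "awalk w p v" "j = length p"
      then show "\<exists>p'. awalk u p' v \<and> length p' = Suc (length p)"
        by (intro exI[of _ "(u, w) # p"]) (simp add: awalk_Cons_iff)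
    qed
    also have "\<dots> \<longleftrightarrow> (\<exists>i<d. \<exists>p. awalk ((d * u + i) mod n) p v \<and> length p = j)"
      unfolding gen_de_bruijn_arc_iff[OF Suc.prems] by blast
    also have "\<dots> \<longleftrightarrow> (\<exists>i<d. \<exists>r<d ^ j. v = (d ^ j * ((d * u + i) mod n) + r) mod n)"
      using Suc by simp
    also have "\<dots> \<longleftrightarrow> (\<exists>i<d. \<exists>r<d ^ j. v = (d ^ Suc j * u + (d ^ j * i + r)) mod n)"
      by (simp only: residue)
    also have "\<dots> \<longleftrightarrow> (\<exists>r<d ^ Suc j. v = (d ^ Suc j * u + r) mod n)"
    proof safe
      fix i r assume "i < d" "r < d ^ j"
      have "d ^ j * i + r < d ^ j * (i + 1)"
        using \<open>r < d ^ j\<close> by simp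
      also have "\<dots> \<le> d ^ j * d"
        using \<open>i < d\<close> by (intro mult_le_mono2) simp
      finally have "d ^ j * i + r < d ^ Suc j" by (simp add: mult.commute)
      then show "\<exists>r'<d ^ Suc j. (d ^ Suc j * u + (d ^ j * i + r)) mod n = (d ^ Suc j * u + r') mod n"
        by blast
    next
      \<comment> \<open>The leading digit of \<open>r\<close> gives the first arc and the remainder
        modulo \<open>d ^ j\<close> gives the rest of the walk.\<close>
      fix r assume "r < d ^ Suc j"
      then have "r div d ^ j < d" "r mod d ^ j < d ^ j"
        by (auto simp: less_mult_imp_div_less intro!: mod_less_divisor gr0I)
      moreover have "r = d ^ j * (r div d ^ j) + r mod d ^ j" by simp
      ultimately show "\<exists>i<d. \<exists>r'<d ^ j.
          (d ^ Suc j * u + r) mod n = (d ^ Suc j * u + (d ^ j * i + r')) mod n"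
        by metis
    qed
    finally show ?case .
  qed
qed

text \<open>Vertices of \<open>D\<close> need no exception on the right, since each reaches itself
  with \<open>j = 0\<close> and \<open>r = 0\<close>.\<close>

lemma dist_dominating_gen_de_bruijn_iff:
  "dist_dominating (with_proj (gen_de_bruijn n d)) k D \<longleftrightarrow>
     D \<subseteq> {0..<n} \<and> (\<forall>v<n. \<exists>u\<in>D. \<exists>j\<le>k. \<exists>r<d ^ j. v = (d ^ j * u + r) mod n)"
proof -
  interpret wf_digraph "with_proj (gen_de_bruijn n d)"
    by (rule wf_digraph_gen_de_bruijn)
  have path_iff: "(\<exists>p. apath u p v \<and> length p \<le> k)
      \<longleftrightarrow> (\<exists>j\<le>k. \<exists>r<d ^ j. v = (d ^ j * u + r) mod n)" if "u < n" for u v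
  proof -
    have "(\<exists>p. apath u p v \<and> length p \<le> k) \<longleftrightarrow> (\<exists>p. awalk u p v \<and> length p \<le> k)"
      using awalk_imp_short_apath awalkI_apath le_trans by metis
    also have "\<dots> \<longleftrightarrow> (\<exists>j\<le>k. \<exists>p. awalk u p v \<and> length p = j)" by blast
    finally show ?thesis
      using gen_de_bruijn_awalk_iff[OF that] by simp
  qed
  have self: "\<exists>j\<le>k. \<exists>r<d ^ j. v = (d ^ j * v + r) mod n" if "v < n" for v
    using that by (intro exI[of _ 0]) auto
  show ?thesis
  proof (cases "D \<subseteq> {0..<n}")
    case True
    define P where "P u v \<longleftrightarrow> (\<exists>j\<le>k. \<exists>r<d ^ j. v = (d ^ j * u + r) mod n)" for u v
    have "(\<exists>u\<in>D. \<exists>p. apath u p v \<and> length p \<le> k) \<longleftrightarrow> (\<exists>u\<in>D. P u v)" for v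
      unfolding P_def using True by (intro bex_cong refl path_iff) auto
    then have "dist_dominating (with_proj (gen_de_bruijn n d)) k D
        \<longleftrightarrow> (\<forall>v\<in>{0..<n} - D. \<exists>u\<in>D. P u v)"
      using True by (simp add: dist_dominating_def)
    also have "\<dots> \<longleftrightarrow> (\<forall>v\<in>{0..<n}. \<exists>u\<in>D. P u v)"
    proof -
      have "\<exists>u\<in>D. P u v" if "v \<in> D" for v
        using that True self unfolding P_def by (intro bexI[of _ v]) auto
      then show ?thesis by blast
    qed
    finally show ?thesis using True by (simp add: P_def Ball_def)
  next
    case False
    then show ?thesis by (simp add: dist_dominating_def)
  qed
qed

lemma gen_de_bruijn_dominating_card_ge:
  assumes "dist_dominating (with_proj (gen_de_bruijn n d)) k D"
  shows "n \<le> (\<Sum>j=0..k. d ^ j) * card D"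
proof -
  have sub: "D \<subseteq> {0..<n}"
    and dom: "\<And>v. v < n \<Longrightarrow> \<exists>u\<in>D. \<exists>j\<le>k. \<exists>r<d ^ j. v = (d ^ j * u + r) mod n"
    using assms by (auto simp: dist_dominating_gen_de_bruijn_iff)
  have fin: "finite D" using sub finite_subset by blast
  let ?X = "D \<times> (SIGMA j:{0..k}. {0..<d ^ j})"
  let ?f = "\<lambda>(u, j, r). (d ^ j * u + r) mod n"
  \<comment> \<open>Every vertex is the value of some triple \<open>(u, j, r)\<close>, so counting
    triples bounds \<open>n\<close>.\<close>
  have "{0..<n} \<subseteq> ?f ` ?X"
    using dom by (fastforce simp: image_iff)
  then have "card {0..<n} \<le> card ?X"
    using fin by (intro surj_card_le) auto
  also have "card ?X = (\<Sum>j=0..k. d ^ j) * card D"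
    by (simp add: card_cartesian_product mult.commute)
  finally show ?thesis by simp
qed

text \<open>If \<open>w\<close> is not below \<open>b k\<close>, then
  \<open>a (Suc k) \<le> b k \<le> w\<close> puts it in the last interval; otherwise induction
  applies. No monotonicity of \<open>a\<close> or \<open>b\<close> is involved.\<close>

lemma abutting_intervals_cover:
  fixes a b :: "nat \<Rightarrow> nat"
  assumes "\<And>j. j < k \<Longrightarrow> a (Suc j) \<le> b j" and "a 0 \<le> w" and "w < b k"
  shows "\<exists>j\<le>k. a j \<le> w \<and> w < b j"
  using assms
proof (induction k)
  case (Suc k)
  show ?case
  proof (cases "w < b k")
    case True
    with Suc show ?thesis by (metis le_SucI less_SucI)
  next
    case False
    with Suc.prems show ?thesis by (metis le_refl lessI linorder_not_le order_trans)
  qed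
qed auto

lemma geometric_sum_Suc_left: "(\<Sum>j<Suc k. d ^ j) = 1 + d * (\<Sum>j<k. d ^ j)" for d :: nat
  by (simp only: sum.lessThan_Suc_shift) (simp add: sum_distrib_left)

lemma exists_residue_ge:
  fixes n v x :: nat
  assumes "v < n"
  obtains w where "x \<le> w" "w < x + n" "w mod n = v"
proof
  \<comment> \<open>Adding \<open>n * x\<close> keeps the residue and makes the subtraction
    \<open>?y - x\<close> exact on naturals.\<close>
  let ?y = "v + n * x"
  let ?w = "x + (?y - x) mod n"
  have "x \<le> ?y" using assms by (simp add: trans_le_add2)
  then have "[?w = ?y] (mod n)"
    by (simp add: cong_def mod_add_right_eq)
  with assms show "?w mod n = v" by (simp add: cong_def)
  show "?w < x + n" using assms by simp
qed simp

lemma gen_de_bruijn_block_dominating: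
  assumes d: "d = Suc e" and m: "m = e * x + c" and le: "x + m \<le> n"
    and length: "n + c * (\<Sum>j<k. d ^ j) \<le> m * (\<Sum>j<Suc k. d ^ j)"
  shows "dist_dominating (with_proj (gen_de_bruijn n d)) k {x..<x + m}"
  unfolding dist_dominating_gen_de_bruijn_iff
proof (intro conjI allI impI)
  show "{x..<x + m} \<subseteq> {0..<n}" using le by auto
next
  fix v assume "v < n"
  then obtain w where w: "x \<le> w" "w < x + n" "w mod n = v"
    by (rule exists_residue_ge)
  have abut: "d ^ Suc j * x \<le> d ^ j * (x + m)" for j
    unfolding d m by (simp add: algebra_simps)
  \<comment> \<open>With \<open>m = e * x + c\<close> this turns the length hypothesis into
    \<open>x + n \<le> d ^ k * (x + m)\<close>: the joined intervals contain \<open>n\<close>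
    consecutive integers from \<open>x\<close> on.\<close>
  have power_eq: "d ^ k = 1 + e * (\<Sum>j<k. d ^ j)"
    by (induction k) (simp_all add: d algebra_simps)
  have "x + n + c * (\<Sum>j<k. d ^ j) \<le> x + m * (\<Sum>j<Suc k. d ^ j)"
    using length by simp
  also have "\<dots> = d ^ k * (x + m) + c * (\<Sum>j<k. d ^ j)"
    using power_eq by (simp add: m algebra_simps)
  finally have "w < d ^ k * (x + m)" using w by linarith
  then obtain j where j: "j \<le> k" "d ^ j * x \<le> w" "w < d ^ j * (x + m)"
    using abutting_intervals_cover[of k "\<lambda>j. d ^ j * x" "\<lambda>j. d ^ j * (x + m)" w] abut w
    by auto
  have pos: "0 < d ^ j" by (simp add: d)
  \<comment> \<open>The \<open>j\<close>-th interval splits into blocks of length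
    \<open>d ^ j\<close>, one per vertex of the set; the quotient finds the block containing
    \<open>w\<close>.\<close>
  define u where "u = w div d ^ j"
  have "u \<in> {x..<x + m}"
    using j pos by (simp add: u_def less_eq_div_iff_mult_less_eq less_mult_imp_div_less mult.commute)
  moreover have "v = (d ^ j * u + w mod d ^ j) mod n"
    using w(3) by (simp add: u_def)
  ultimately show "\<exists>u\<in>{x..<x + m}. \<exists>j\<le>k. \<exists>r<d ^ j. v = (d ^ j * u + r) mod n"
    using j(1) pos mod_less_divisor by blast
qed

theorem theorem2p4:
  fixes d k n p q :: nat
  assumes "d \<ge> 2" and "k \<ge> 1" and "p \<ge> 1"
    and "n = p * (\<Sum>j=0..k. d ^ j) + q"
    and "1 \<le> q" and "q \<le> min (1 + 2 * (\<Sum>j=0..k-1. d ^ j)) (\<Sum>j=1..k. d ^ j)"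
  shows "int (dist_domination_number k (with_proj (gen_de_bruijn n d)))
           = \<lceil>real n / real (\<Sum>j=0..k. d ^ j)\<rceil>"
proof -
  let ?G = "with_proj (gen_de_bruijn n d)"
  define S T where "S = (\<Sum>j=0..k. d ^ j)" and "T = (\<Sum>j<k. d ^ j)"
  have S_eq: "S = (\<Sum>j<Suc k. d ^ j)"
    unfolding S_def by (rule sum.cong) auto
  have ST: "S = 1 + d * T"
    unfolding S_eq T_def by (rule geometric_sum_Suc_left)
  have T': "(\<Sum>j=0..k-1. d ^ j) = T"
    unfolding T_def using assms(2) by (intro sum.cong) auto
  have S': "S = 1 + (\<Sum>j=1..k. d ^ j)"
    unfolding S_def by (subst sum.atLeast_Suc_atMost) simp_all
  have n: "n = p * S + q" using assms(4) S_def by simp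
  \<comment> \<open>The second entry of the minimum is \<open>S - 1\<close>, so \<open>n\<close>
    lies strictly between \<open>p * S\<close> and \<open>(p + 1) * S\<close>.\<close>
  have q: "1 \<le> q" "q \<le> 1 + 2 * T" "q < S"
    using assms(5,6) T' S' by auto
  have T_pos: "1 \<le> T"
    unfolding T_def using assms(2) by (cases k) (auto simp: sum.lessThan_Suc_shift simp del: sum.lessThan_Suc)
  obtain e where e: "d = Suc e" "1 \<le> e" using assms(1) by (cases d) auto
  define x c where "x = (p + 1) div e" and "c = (p + 1) mod e"
  have m: "p + 1 = e * x + c" by (simp add: x_def c_def)
  have "c + 1 \<le> e" using e by (simp add: c_def Suc_le_eq)
  then have "c * T + T \<le> e * T"
    by (metis add_mult_distrib mult_1 mult_le_mono1)
  \<comment> \<open>Here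
    \<open>q + c * T \<le> 1 + 2 * T + (e - 1) * T = 1 + d * T = S\<close>.\<close>
  then have "n + c * T \<le> (p + 1) * S"
    using q ST e by (simp add: n algebra_simps)
  \<comment> \<open>The block fits among the vertices: \<open>S \<ge> 3\<close> gives
    \<open>n \<ge> 3 * p + 1 \<ge> 2 * (p + 1)\<close>.\<close>
  moreover have "x + (p + 1) \<le> n"
  proof -
    have "2 * 1 \<le> d * T" using assms(1) T_pos by (rule mult_le_mono)
    then have "p * 3 \<le> p * S" using ST by (intro mult_le_mono2) simp
    moreover have "x \<le> p + 1" by (simp add: x_def)
    ultimately show ?thesis using n q assms(3) by linarith
  qed
  ultimately have dom: "dist_dominating ?G k {x..<x + (p + 1)}"
    using gen_de_bruijn_block_dominating[OF e(1) m] by (simp add: S_eq T_def)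
  have "dist_domination_number k ?G = p + 1"
    unfolding dist_domination_number_def
  proof (rule Least_equality)
    show "\<exists>D. finite D \<and> dist_dominating ?G k D \<and> card D = p + 1"
      using dom by (intro exI[of _ "{x..<x + (p + 1)}"]) simp
  next
    fix m assume "\<exists>D. finite D \<and> dist_dominating ?G k D \<and> card D = m"
    then have "n \<le> S * m"
      using gen_de_bruijn_dominating_card_ge S_def by blast
    moreover have "S * p < n" using n q by (simp add: mult.commute)
    ultimately have "S * p < S * m" by (rule less_le_trans[rotated])
    then show "p + 1 \<le> m" by simp
  qed
  moreover have "\<lceil>real n / real S\<rceil> = int p + 1"
  proof (rule ceiling_unique)
    show "of_int (int p + 1) - 1 < real n / real S"
      using n q by (simp add: field_simps)
    show "real n / real S \<le> of_int (int p + 1)"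
      using n q by (simp add: field_simps)
  qed
  ultimately show ?thesis by (simp add: S_def)
qed

end
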